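(* Let $F:\mathbb{R}^n\to\mathbb{R}\cup\{+\infty\}$ be a function with set of minimizers $X^*\neq\emptyset$ and minimum value $F^*$, let $x_0\in\mathrm{dom}\,F$, $\gamma>0$, and suppose that there are $\kappa>0$ and $q\in[1,2]$ such that $$F(x)-F^*\ \ge\ \frac{\kappa}{q}\|x-\bar x\|^q\qquad\forall x\in\mathcal{L}_F(x_0).$$ Let $F_\gamma$ be a smooth approximation of $F$ as specified below; if $q\in[1,2)$, assume additionally that there is $R>0$ such that $\|x-\bar x\|\le R$ for all $x\in\mathcal{L}_{F_\gamma}(x_0)$. (a) If $F$ is a proper closed convex function and $F_\gamma$ is the Moreau envelope of $F$, then $$F_\gamma(x)-F_\gamma^*\ \ge\ \frac{\hat\kappa}{2}\|x-\bar x\|_1^2\qquad\forall x\in\mathcal{L}_{F_\gamma}(x_0),\tag{$*$}$$ with $$\hat\kappa=\frac{\kappa\gamma}{\gamma\kappa+1}\ \text{ if } q=2,\qquad \hat\kappa=\frac{\kappa^2\gamma^2}{(\kappa\gamma+R^{2-q})^2}\ \text{ if } q\in[1,2).$$ (b) If $F=f+\psi$, where $f$ has Lipschitz gradient with constant $L>0$ and $\psi$ is a proper closed convex function, and $F_\gamma$ is the Forward-Backward envelope of $(f,\psi)$ with $\gamma L\in(0,1)$, then $( * )$ holds with $$\hat\kappa=\frac{\kappa(1-\gamma L)}{(\gamma\kappa+1-\gamma L)L_{\max}}\ \text{ if } q=2,\qquad \hat\kappa=\frac{\kappa^2\gamma(1-\gamma L)}{(\kappa\gamma+R^{2-q}(1-\gamma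 L))^2L_{\max}}\ \text{ if } q\in[1,2).$$
   Context: $\|\cdot\|$ is the Euclidean norm. For $x\in\mathbb{R}^n$, $\bar x=[x]_{X^*}$ is the projection of $x$ onto $X^*$. Level sets: $\mathcal{L}_F(y)=\{x\in\mathrm{dom}\,F: F(x)\le F(y)\}$, and similarly $\mathcal{L}_{F_\gamma}(y)=\{x\in\mathrm{dom}\,F_\gamma: F_\gamma(x)\le F_\gamma(y)\}$. $F_\gamma^*=\min_x F_\gamma(x)$. Moreau envelope of $F$: $F_\gamma(x)=\min_{u\in\mathbb{R}^n}\{F(u)+\frac{1}{2\gamma}\|u-x\|^2\}$. Forward-Backward envelope of $(f,\psi)$: $F_\gamma(x)=\min_{u\in\mathbb{R}^n}\{f(x)+\langle\nabla f(x),u-x\rangle+\frac{1}{2\gamma}\|u-x\|^2+\psi(u)\}$. Blocks: $U=[U_1,\dots,U_N]$ is a column permutation of the $n\times n$ identity matrix, with $U_i\in\mathbb{R}^{n\times n_i}$, $\sum_i n_i=n$; $x^{(i)}=U_i^Tx$. On each $\mathbb{R}^{n_i}$ some norm $\|\cdot\|_{(i)}$ is fixed. The constants $L_i(F_\gamma)>0$ are block coordinate-wise Lipschitz constants of $\nabla F_\gamma$, i.e. $\|U_i^T(\nabla F_\gamma(x+U_ih)-\nabla F_\gamma(x))\|_{(i)}\le L_i(F_\gamma)\|h\|_{(i)}$ for all $x\in\mathbb{R}^n$, $h\in\mathbb{R}^{n_i}$, $i=1,\dots,N$; for the Moreau envelope they are taken to be $L_i(F_\gamma)=\gamma^{-1}$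 for all $i$; for the Forward-Backward envelope such constants are presupposed. $L_{\max}=\max_{i}L_i(F_\gamma)$ and $\|x\|_1^2=\sum_{i=1}^N L_i(F_\gamma)\|x^{(i)}\|_{(i)}^2$.
   Formalization: The block norms are additionally assumed to satisfy ‖h‖_(i) ≤ ‖h‖ (Euclidean norm); for arbitrary norms the claim is false, e.g. n=N=1, F(x)=κx²/2, q=2, ‖h‖_(1)=c|h| with c>1. *)

theory Defs
  imports "HOL-Analysis.Analysis"
begin

section \<open>Extended-valued functions\<close>

definition edom :: "('a \<Rightarrow> ereal) \<Rightarrow> 'a set"
  where "edom F = {x. F x < \<infinity>}"

definition minimizers :: "('a \<Rightarrow> ereal) \<Rightarrow> 'a set"
  where "minimizers F = {x. \<forall>y. F x \<le> F y}"

definition level_set :: "('a \<Rightarrow> ereal) \<Rightarrow> 'a \<Rightarrow> 'a set"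
  where "level_set F y = {x \<in> edom F. F x \<le> F y}"

text \<open>The library's \<^term>\<open>epigraph\<close> and \<^term>\<open>convex_on\<close> are for real-valued functions only;
  convexity and closedness of an extended-valued function are those of its epigraph.\<close>

definition epi :: "('a \<Rightarrow> ereal) \<Rightarrow> ('a \<times> real) set"
  where "epi F = {(x, r). F x \<le> ereal r}"

definition proper_closed_convex :: "('a::euclidean_space \<Rightarrow> ereal) \<Rightarrow> bool"
  where "proper_closed_convex F \<longleftrightarrow>
    (\<forall>x. F x \<noteq> -\<infinity>) \<and> edom F \<noteq> {} \<and> closed (epi F) \<and> convex (epi F)"


section \<open>Envelopes\<close>

text \<open>Both envelopes are defined as infima. For a proper closed convex \<open>F\<close>, respectively \<open>\<psi>\<close>, and
  \<open>\<gamma> > 0\<close> the objective in \<open>u\<close> is proper, closed and strongly convex, so the infimum is finite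
  and is a minimum.\<close>

definition moreau_envelope :: "real \<Rightarrow> ('a::euclidean_space \<Rightarrow> ereal) \<Rightarrow> 'a \<Rightarrow> ereal"
  where "moreau_envelope \<gamma> F x = (INF u. F u + ereal (1 / (2 * \<gamma>) * (norm (u - x))\<^sup>2))"

text \<open>The argument \<open>gf\<close> stands for the gradient of \<open>f\<close>.\<close>

definition fb_envelope ::
  "real \<Rightarrow> ('a::euclidean_space \<Rightarrow> real) \<Rightarrow> ('a \<Rightarrow> 'a) \<Rightarrow> ('a \<Rightarrow> ereal) \<Rightarrow> 'a \<Rightarrow> ereal"
  where "fb_envelope \<gamma> f gf \<psi> x =
    (INF u. ereal (f x + inner (gf x) (u - x) + 1 / (2 * \<gamma>) * (norm (u - x))\<^sup>2) + \<psi> u)"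


section \<open>Blocks\<close>

text \<open>The sizes \<open>m i\<close> of the blocks vary with \<open>i\<close>, so \<open>\<real>\<^sup>m\<close> is the set of functions
  \<open>nat \<Rightarrow> real\<close> that vanish from index \<open>m\<close> on.\<close>

definition Rspace :: "nat \<Rightarrow> (nat \<Rightarrow> real) set"
  where "Rspace m = {h. \<forall>j\<ge>m. h j = 0}"

definition is_norm :: "nat \<Rightarrow> ((nat \<Rightarrow> real) \<Rightarrow> real) \<Rightarrow> bool"
  where "is_norm m \<nu> \<longleftrightarrow>
    (\<forall>h\<in>Rspace m. 0 \<le> \<nu> h \<and> (\<nu> h = 0 \<longleftrightarrow> h = (\<lambda>j. 0))) \<and>
    (\<forall>c. \<forall>h\<in>Rspace m. \<nu> (\<lambda>j. c * h j) = \<bar>c\<bar> * \<nu> h) \<and>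
    (\<forall>g\<in>Rspace m. \<forall>h\<in>Rspace m. \<nu> (\<lambda>j. g j + h j) \<le> \<nu> g + \<nu> h)"

text \<open>Multiplying a norm \<open>\<nu>\<close> by a constant does not change its Lipschitz constants (the same norm is
  used on both sides) but scales the growth bound below, which hence fails for unrestricted
  norms. Domination by the Euclidean norm is what the bound needs: for \<open>F x = \<kappa> / 2 * \<parallel>x\<parallel>\<^sup>2\<close> and
  \<open>q = 2\<close> the bound for the Moreau envelope is equivalent to it.\<close>

definition euclidean_dominated :: "nat \<Rightarrow> ((nat \<Rightarrow> real) \<Rightarrow> real) \<Rightarrow> bool"
  where "euclidean_dominated m \<nu> \<longleftrightarrow> (\<forall>h\<in>Rspace m. \<nu> h \<le> L2_set h {..<m})"

text \<open>The vector \<open>U i j\<close> is the \<open>j\<close>-th column of the \<open>i\<close>-th block \<open>U\<^sub>i\<close> (both indices start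
  at \<open>0\<close>). That \<open>[U\<^sub>0, \<dots>, U\<^sub>N\<^sub>-\<^sub>1]\<close> is a column permutation of the identity matrix says that the
  pairs \<open>(i, j)\<close> enumerate the columns of the identity matrix without repetition; in particular
  the sizes \<open>m i\<close> add up to the dimension.\<close>

definition block_decomposition :: "nat \<Rightarrow> (nat \<Rightarrow> nat) \<Rightarrow> (nat \<Rightarrow> nat \<Rightarrow> real^'n) \<Rightarrow> bool"
  where "block_decomposition N m U \<longleftrightarrow>
    bij_betw (\<lambda>(i, j). U i j) (SIGMA i:{..<N}. {..<m i}) (columns (mat 1 :: real^'n^'n))"

text \<open>The maps \<open>x \<mapsto> U\<^sub>i\<^sup>T x\<close> and \<open>h \<mapsto> U\<^sub>i h\<close>.\<close>

definition block :: "(nat \<Rightarrow> nat) \<Rightarrow> (nat \<Rightarrow> nat \<Rightarrow> real^'n) \<Rightarrow> nat \<Rightarrow> real^'n \<Rightarrow> (nat \<Rightarrow> real)"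
  where "block m U i x = (\<lambda>j. if j < m i then inner (U i j) x else 0)"

definition unblock :: "(nat \<Rightarrow> nat) \<Rightarrow> (nat \<Rightarrow> nat \<Rightarrow> real^'n) \<Rightarrow> nat \<Rightarrow> (nat \<Rightarrow> real) \<Rightarrow> real^'n"
  where "unblock m U i h = (\<Sum>j<m i. h j *\<^sub>R U i j)"

definition block_lipschitz ::
  "nat \<Rightarrow> (nat \<Rightarrow> nat) \<Rightarrow> (nat \<Rightarrow> nat \<Rightarrow> real^'n) \<Rightarrow> (nat \<Rightarrow> (nat \<Rightarrow> real) \<Rightarrow> real) \<Rightarrow>
    (nat \<Rightarrow> real) \<Rightarrow> (real^'n \<Rightarrow> real^'n) \<Rightarrow> bool"
  where "block_lipschitz N m U \<nu> Lc G \<longleftrightarrow>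
    (\<forall>i<N. \<forall>x. \<forall>h\<in>Rspace (m i).
      \<nu> i (block m U i (G (x + unblock m U i h) - G x)) \<le> Lc i * \<nu> i h)"

definition block_norm_sq ::
  "nat \<Rightarrow> (nat \<Rightarrow> nat) \<Rightarrow> (nat \<Rightarrow> nat \<Rightarrow> real^'n) \<Rightarrow> (nat \<Rightarrow> (nat \<Rightarrow> real) \<Rightarrow> real) \<Rightarrow>
    (nat \<Rightarrow> real) \<Rightarrow> real^'n \<Rightarrow> real"
  where "block_norm_sq N m U \<nu> Lc x = (\<Sum>i<N. Lc i * (\<nu> i (block m U i x))\<^sup>2)"


section \<open>Growth conditions\<close>

text \<open>The projection of \<open>x\<close> onto the set of minimizers of \<open>F\<close>. If that set is not convex,
  \<^term>\<open>closest_point\<close> selects one of the nearest points.\<close>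

definition proj_min :: "('a::euclidean_space \<Rightarrow> ereal) \<Rightarrow> 'a \<Rightarrow> 'a"
  where "proj_min F x = closest_point (minimizers F) x"

definition sharp_growth :: "('a::euclidean_space \<Rightarrow> ereal) \<Rightarrow> 'a \<Rightarrow> real \<Rightarrow> real \<Rightarrow> bool"
  where "sharp_growth F x0 \<kappa> q \<longleftrightarrow>
    (\<forall>x\<in>level_set F x0. F x - (INF y. F y) \<ge> ereal (\<kappa> / q * norm (x - proj_min F x) powr q))"

definition bounded_level :: "('a::euclidean_space \<Rightarrow> ereal) \<Rightarrow> ('a \<Rightarrow> ereal) \<Rightarrow> 'a \<Rightarrow> real \<Rightarrow> bool"
  where "bounded_level F F\<gamma> x0 R \<longleftrightarrow> (\<forall>x\<in>level_set F\<gamma> x0. norm (x - proj_min F x) \<le> R)"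

text \<open>\<open>nsq\<close> is the square of the norm measuring the distance to the minimizers of \<open>F\<close>.\<close>

definition envelope_growth ::
  "('a::euclidean_space \<Rightarrow> ereal) \<Rightarrow> ('a \<Rightarrow> ereal) \<Rightarrow> 'a \<Rightarrow> ('a \<Rightarrow> real) \<Rightarrow> real \<Rightarrow> bool"
  where "envelope_growth F F\<gamma> x0 nsq \<kappa>' \<longleftrightarrow>
    (\<forall>x\<in>level_set F\<gamma> x0. F\<gamma> x - (INF y. F\<gamma> y) \<ge> ereal (\<kappa>' / 2 * nsq (x - proj_min F x)))"

end

theory Submission
  imports Defs
begin

text \<open>
  Both envelopes have the same two properties: they lie below \<open>F\<close>, and for every \<open>x\<close> there is a
  point \<open>p\<close> with \<open>F p + \<parallel>p - x\<parallel>\<^sup>2 / (2 * \<mu>) \<le> F\<^sub>\<gamma> x\<close>. For the Moreau envelope \<open>p\<close> is the proximal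
  point and \<open>\<mu> = \<gamma>\<close>. For the Forward-Backward envelope \<open>p\<close> is the forward-backward step; there the
  descent lemma bounds the linearisation of \<open>f\<close> at \<open>x\<close> from below by \<open>f p - L / 2 * \<parallel>p - x\<parallel>\<^sup>2\<close>, which
  leaves \<open>1 / \<mu> = 1 / \<gamma> - L\<close>, that is, \<open>\<mu> = \<gamma> / (1 - \<gamma> * L)\<close>. In both cases \<open>p\<close> exists because the
  objective is lower semicontinuous and, \<open>F\<close> being bounded below, grows quadratically
  (\<open>lsc_minimum_attained\<close>).

  The growth bound follows from these two properties alone (\<open>envelope_growth_of_minorant\<close>). They
  give \<open>F\<^sub>\<gamma>\<close> the same infimum \<open>F\<^sup>*\<close> as \<open>F\<close>, and they put \<open>p\<close> into the level set of \<open>F\<close> whenever \<open>x\<close>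
  is in that of \<open>F\<^sub>\<gamma>\<close>. So the growth of \<open>F\<close> applies at \<open>p\<close>: with \<open>a\<close> the distance from \<open>p\<close> to the
  minimizers and \<open>b = \<parallel>p - x\<parallel>\<close>, the gap \<open>F\<^sub>\<gamma> x - F\<^sup>*\<close> is at least \<open>\<kappa> / q * a\<^sup>q + b\<^sup>2 / (2 * \<mu>)\<close>, while
  the distance from \<open>x\<close> to the minimizers is at most \<open>a + b\<close>. Splitting that distance in the worst
  way gives a quadratic bound with constant \<open>\<kappa> / (\<kappa> * \<mu> + \<rho>)\<close>, where \<open>\<rho>\<close> is the price of replacing
  \<open>a\<^sup>q\<close> by \<open>a\<^sup>2\<close>: it is \<open>1\<close> for \<open>q = 2\<close> and \<open>R powr (2 - q)\<close> below.

  Finally, since the blocks split the coordinates and their norms are dominated by the Euclidean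
  norm, the weighted block norm is at most the largest weight times the Euclidean one
  (\<open>block_norm_sq_le\<close>). So the quadratic constant divided by the largest weight serves for the block
  norm. For \<open>q = 2\<close> this is the constant of the theorem; for \<open>q < 2\<close> that constant is smaller, by
  the factor \<open>\<kappa> * \<mu> / (\<kappa> * \<mu> + \<rho>)\<close>.
\<close>

section \<open>Lower semicontinuity and attainment\<close>

lemma ereal_add_real_le_iff: "h + ereal g \<le> ereal r \<longleftrightarrow> h \<le> ereal (r - g)"
  by (cases h) auto

lemma closed_sublevel_add_continuous:
  fixes h :: "'a::euclidean_space \<Rightarrow> ereal"
  assumes "closed (epi h)" and "continuous_on UNIV g"
  shows "closed {u. h u + ereal (g u) \<le> ereal r}"
proof -
  have "{u. h u + ereal (g u) \<le> ereal r} = (\<lambda>u. (u, r - g u)) -` epi h"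
    by (auto simp: epi_def ereal_add_real_le_iff)
  moreover have "continuous_on UNIV (\<lambda>u. (u, r - g u))"
    by (intro continuous_intros assms)
  ultimately show ?thesis
    using closed_vimage[OF assms(1)] by simp
qed

text \<open>The sublevel sets at the levels \<open>Inf + 1 / (n + 1)\<close> are nonempty, compact and nested; a common
  point of theirs is a minimizer.\<close>

lemma lsc_minimum_attained:
  fixes h :: "'a::euclidean_space \<Rightarrow> ereal"
  assumes cl: "closed (epi h)" and g: "continuous_on UNIV g" and "c > 0"
    and lower: "\<And>u. h u + ereal (g u) \<ge> ereal (B + c * (norm (u - x))\<^sup>2)"
  shows "\<exists>p. h p + ereal (g p) \<le> (INF u. h u + ereal (g u))"
proof (cases "INF u. h u + ereal (g u)")
  case PInf
  then show ?thesis by simp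
next
  case MInf
  have "ereal B \<le> (INF u. h u + ereal (g u))"
  proof (rule INF_greatest)
    fix u
    have "ereal B \<le> ereal (B + c * (norm (u - x))\<^sup>2)" using \<open>c > 0\<close> by simp
    then show "ereal B \<le> h u + ereal (g u)" using lower order_trans by blast
  qed
  with MInf show ?thesis by simp
next
  case (real I)
  define K where "K n = {u. h u + ereal (g u) \<le> ereal (I + 1 / real (Suc n))}" for n
  have "bounded (K n)" for n
  proof -
    have "norm (u - x) \<le> 1 + (I + 1 / real (Suc n) - B) / c" if "u \<in> K n" for u
    proof -
      have "ereal (B + c * (norm (u - x))\<^sup>2) \<le> ereal (I + 1 / real (Suc n))"
        using order_trans[OF lower[of u]] that unfolding K_def by blast
      then have "(norm (u - x))\<^sup>2 \<le> (I + 1 / real (Suc n) - B) / c"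
        using \<open>c > 0\<close> by (simp add: pos_le_divide_eq mult.commute)
      moreover have "norm (u - x) \<le> 1 + (norm (u - x))\<^sup>2"
        using sum_squares_bound[of "norm (u - x)" 1] zero_le_power2[of "norm (u - x)"]
        unfolding mult_1_right power_one by linarith
      ultimately show ?thesis by linarith
    qed
    then have "K n \<subseteq> cball x (1 + (I + 1 / real (Suc n) - B) / c)"
      by (auto simp: dist_norm norm_minus_commute)
    then show ?thesis using bounded_cball bounded_subset by blast
  qed
  moreover have "closed (K n)" for n
    unfolding K_def by (rule closed_sublevel_add_continuous[OF cl g])
  ultimately have "compact (K n)" for n
    by (simp add: compact_eq_bounded_closed)
  moreover have "K n \<noteq> {}" for n
  proof -
    have "(INF u. h u + ereal (g u)) < ereal (I + 1 / real (Suc n))" using real by simp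
    then obtain u where "h u + ereal (g u) < ereal (I + 1 / real (Suc n))"
      unfolding INF_less_iff by auto
    then show ?thesis unfolding K_def by (auto intro: less_imp_le)
  qed
  moreover have "K n \<subseteq> K k" if "k \<le> n" for k n
  proof -
    have "1 / real (Suc n) \<le> 1 / real (Suc k)" using that by (intro divide_left_mono) auto
    then have "ereal (I + 1 / real (Suc n)) \<le> ereal (I + 1 / real (Suc k))" by simp
    then show ?thesis unfolding K_def by (blast intro: order_trans)
  qed
  ultimately have "\<Inter> (range K) \<noteq> {}" by (rule compact_nest)
  then obtain p where p: "p \<in> K n" for n by auto
  have "h p + ereal (g p) \<le> ereal I"
  proof (rule ereal_le_epsilon2)
    fix e :: real assume "e > 0"
    then obtain n where "1 / real (Suc n) < e" using nat_approx_posE by blast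
    then have "ereal (I + 1 / real (Suc n)) \<le> ereal (I + e)" by simp
    then show "h p + ereal (g p) \<le> ereal I + ereal e"
      using p[of n] unfolding K_def by (auto intro: order_trans)
  qed
  then show ?thesis using real by auto
qed

section \<open>From a quadratic minorant to growth\<close>

text \<open>A minimizer turns the minimal value into a real number, so that the set of minimizers is a
  sublevel set; for lower semicontinuous \<open>F\<close> it is therefore closed, which nearest points require.\<close>

lemma minimum_value:
  fixes F :: "'a \<Rightarrow> ereal"
  assumes "\<forall>x. F x \<noteq> -\<infinity>" and "minimizers F \<noteq> {}" and "x0 \<in> edom F"
  obtains B where "(INF y. F y) = ereal B" and "\<And>x. ereal B \<le> F x"
    and "minimizers F = {x. F x \<le> ereal B}"
proof -
  obtain z where z: "F z \<le> F y" for y using assms(2) unfolding minimizers_def by auto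
  have "F z < \<infinity>" using z[of x0] assms(3) unfolding edom_def by (auto intro: le_less_trans)
  with assms(1) obtain B where B: "F z = ereal B" by (cases "F z") auto
  have "(INF y. F y) = ereal B"
    using z B by (metis INF_lower INF_greatest UNIV_I antisym)
  moreover have "minimizers F = {x. F x \<le> ereal B}"
    unfolding minimizers_def using z B by (metis (no_types) order_trans)
  ultimately show thesis using that z B by metis
qed

text \<open>The bound is the minimum of the right-hand side over \<open>a + b = d\<close>. Since \<open>a\<close> may exceed \<open>d\<close>, it
  is first cut off there, where the comparison of \<open>t powr q\<close> with \<open>t\<^sup>2\<close> is available.\<close>

lemma split_distance_bound:
  fixes a b d :: real
  assumes "\<kappa> > 0" "\<mu> > 0" "\<rho> > 0" "0 < q" "q \<le> 2"
    and "0 \<le> a" "0 \<le> b" "0 \<le> d" "d \<le> a + b"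
    and comparison: "\<And>t. 0 \<le> t \<Longrightarrow> t \<le> d \<Longrightarrow> t\<^sup>2 \<le> \<rho> * t powr q"
  shows "\<kappa> / (\<kappa> * \<mu> + \<rho>) / 2 * d\<^sup>2 \<le> \<kappa> / q * a powr q + 1 / (2 * \<mu>) * b\<^sup>2"
proof -
  define t where "t = min a d"
  have t: "0 \<le> t" "t \<le> d" "t \<le> a" "d \<le> t + b" using assms by (auto simp: t_def)
  have pos: "\<kappa> * \<mu> + \<rho> > 0" using assms by (simp add: add_pos_pos)
  have "d\<^sup>2 \<le> (t + b)\<^sup>2" using t assms by (intro power_mono) auto
  then have "\<kappa> * \<mu> * \<rho> * d\<^sup>2 \<le> \<kappa> * \<mu> * \<rho> * (t + b)\<^sup>2"
    using assms by (intro mult_left_mono) auto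
  also have "\<dots> \<le> (\<kappa> * \<mu> + \<rho>) * (\<kappa> * \<mu> * t\<^sup>2 + \<rho> * b\<^sup>2)"
  proof -
    have "(\<kappa> * \<mu> + \<rho>) * (\<kappa> * \<mu> * t\<^sup>2 + \<rho> * b\<^sup>2) - \<kappa> * \<mu> * \<rho> * (t + b)\<^sup>2
        = (\<kappa> * \<mu> * t - \<rho> * b)\<^sup>2"
      by (simp add: power2_eq_square algebra_simps)
    then show ?thesis by (smt (verit) zero_le_power2)
  qed
  finally have key: "\<kappa> / (\<kappa> * \<mu> + \<rho>) * d\<^sup>2 \<le> \<kappa> * (t\<^sup>2 / \<rho>) + b\<^sup>2 / \<mu>"
    using pos assms by (simp add: field_simps)
  have "t\<^sup>2 / \<rho> \<le> t powr q"
    using comparison t assms by (simp add: divide_le_eq mult.commute)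
  also have "\<dots> \<le> a powr q" using t assms by (intro powr_mono2) auto
  finally have "\<kappa> / 2 * (t\<^sup>2 / \<rho>) \<le> \<kappa> / q * a powr q"
    using assms by (intro mult_mono) (auto simp: field_simps)
  moreover have "v / 2 \<le> z + y / 2" if "v \<le> k * w + y" "k / 2 * w \<le> z" for v w y z k :: real
    using that by (simp add: field_simps)
  ultimately have "\<kappa> / (\<kappa> * \<mu> + \<rho>) * d\<^sup>2 / 2 \<le> \<kappa> / q * a powr q + b\<^sup>2 / \<mu> / 2"
    using key by blast
  then show ?thesis by (simp add: mult.commute)
qed

text \<open>The parameter \<open>\<rho>\<close> covers both ranges of \<open>q\<close>: the comparison holds with \<open>\<rho> = 1\<close> for \<open>q = 2\<close>, and
  with \<open>\<rho> = R powr (2 - q)\<close> if all distances occurring are at most \<open>R\<close>.\<close>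

lemma envelope_growth_of_minorant:
  fixes F E :: "'a::euclidean_space \<Rightarrow> ereal"
  assumes F: "\<forall>x. F x \<noteq> -\<infinity>" "minimizers F \<noteq> {}" "x0 \<in> edom F" "closed (minimizers F)"
    and const: "\<kappa> > 0" "\<mu> > 0" "\<rho> > 0" "0 < q" "q \<le> 2"
    and growth: "sharp_growth F x0 \<kappa> q"
    and upper: "\<And>x. E x \<le> F x"
    and minorant: "\<And>x. \<exists>p. F p + ereal (1 / (2 * \<mu>) * (norm (p - x))\<^sup>2) \<le> E x"
    and comparison: "\<And>x t. x \<in> level_set E x0 \<Longrightarrow> 0 \<le> t \<Longrightarrow> t \<le> norm (x - proj_min F x) \<Longrightarrow>
      t\<^sup>2 \<le> \<rho> * t powr q"
  shows "envelope_growth F E x0 (\<lambda>y. (norm y)\<^sup>2) (\<kappa> / (\<kappa> * \<mu> + \<rho>))"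
  unfolding envelope_growth_def
proof
  fix x assume x: "x \<in> level_set E x0"
  obtain B where B: "(INF y. F y) = ereal B" "\<And>x. ereal B \<le> F x"
    using minimum_value[OF F(1-3)] by metis
  have le_plus: "F p \<le> F p + ereal (1 / (2 * \<mu>) * (norm (p - y))\<^sup>2)" for p y
    using const by (simp add: ereal_le_add_self)
  have "ereal B \<le> E y" for y using B(2) le_plus minorant[of y] by (blast intro: order_trans)
  moreover have "(INF y. E y) \<le> (INF y. F y)" by (rule INF_mono') (rule upper)
  ultimately have inf: "(INF y. E y) = ereal B" using B(1) by (metis INF_greatest antisym)
  obtain p where p: "F p + ereal (1 / (2 * \<mu>) * (norm (p - x))\<^sup>2) \<le> E x"
    using minorant by blast
  have Ex: "E x \<le> F x0" "E x < \<infinity>"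
    using x upper[of x0] unfolding level_set_def edom_def by (auto intro: order_trans)
  have Fp: "F p \<le> E x" using le_plus p by (rule order_trans)
  then have "p \<in> level_set F x0"
    using Ex unfolding level_set_def edom_def by (auto intro: le_less_trans)
  with growth B have gp: "F p - ereal B \<ge> ereal (\<kappa> / q * norm (p - proj_min F p) powr q)"
    unfolding sharp_growth_def by auto
  obtain s where s: "F p = ereal s" using F(1) Fp Ex(2) by (cases "F p") auto
  obtain e where e: "E x = ereal e" using Fp s Ex(2) by (cases "E x") auto
  have "norm (x - proj_min F x) \<le> norm (x - proj_min F p)"
    using closest_point_le[OF F(4) closest_point_in_set[OF F(4,2)], of x p]
    unfolding proj_min_def dist_norm .
  also have "\<dots> \<le> norm (p - proj_min F p) + norm (p - x)"
    using norm_triangle_ineq[of "p - proj_min F p" "x - p"] by (simp add: norm_minus_commute)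
  finally have "\<kappa> / (\<kappa> * \<mu> + \<rho>) / 2 * (norm (x - proj_min F x))\<^sup>2
      \<le> \<kappa> / q * norm (p - proj_min F p) powr q + 1 / (2 * \<mu>) * (norm (p - x))\<^sup>2"
    using const comparison[OF x] by (intro split_distance_bound) auto
  also have "\<dots> \<le> e - B" using gp p s e by simp
  finally show "E x - (INF y. E y)
      \<ge> ereal (\<kappa> / (\<kappa> * \<mu> + \<rho>) / 2 * (norm (x - proj_min F x))\<^sup>2)"
    using inf e by simp
qed

lemma envelope_growth_mono:
  assumes "envelope_growth F E x0 nsq k" and "\<And>y. k' * nsq' y \<le> k * nsq y"
  shows "envelope_growth F E x0 nsq' k'"
  unfolding envelope_growth_def
proof
  fix x assume "x \<in> level_set E x0"
  with assms(1) have "ereal (k / 2 * nsq (x - proj_min F x)) \<le> E x - (INF y. E y)"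
    unfolding envelope_growth_def by blast
  moreover have "k' / 2 * nsq' (x - proj_min F x) \<le> k / 2 * nsq (x - proj_min F x)"
    using assms(2)[of "x - proj_min F x"] by simp
  ultimately show "ereal (k' / 2 * nsq' (x - proj_min F x)) \<le> E x - (INF y. E y)"
    using order_trans ereal_less_eq(3) by metis
qed

lemma square_le_powr:
  fixes q R t :: real
  assumes "q < 2" "0 \<le> t" "t \<le> R"
  shows "t\<^sup>2 \<le> R powr (2 - q) * t powr q"
proof (cases "t = 0")
  case False
  then have "t\<^sup>2 = t powr (2 - q) * t powr q"
    using assms by (simp flip: powr_add)
  also have "\<dots> \<le> R powr (2 - q) * t powr q"
    using assms by (intro mult_right_mono powr_mono2) auto
  finally show ?thesis .
qed simp

section \<open>Block norms\<close>

lemma columns_mat_1: "columns (mat 1 :: real^'n^'n) = Basis"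
proof -
  have "column i (mat 1 :: real^'n^'n) = axis i 1" for i
    by (vector column_def mat_def axis_def)
  then show ?thesis unfolding columns_def Basis_vec_def by auto
qed

lemma block_decomposition_nonempty:
  fixes U :: "nat \<Rightarrow> nat \<Rightarrow> real^'n"
  assumes "block_decomposition N m U"
  shows "N > 0"
proof (rule ccontr)
  assume "\<not> N > 0"
  then have "(Basis :: (real^'n) set) = {}"
    using assms unfolding block_decomposition_def columns_mat_1 bij_betw_def by auto
  then show False by simp
qed

text \<open>The blocks of \<open>x\<close> together list each coordinate of \<open>x\<close> exactly once.\<close>

lemma sum_block_L2_set:
  fixes U :: "nat \<Rightarrow> nat \<Rightarrow> real^'n"
  assumes "block_decomposition N m U"
  shows "(\<Sum>i<N. (L2_set (block m U i x) {..<m i})\<^sup>2) = (norm x)\<^sup>2"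
proof -
  have "(\<Sum>i<N. (L2_set (block m U i x) {..<m i})\<^sup>2) = (\<Sum>i<N. \<Sum>j<m i. (inner (U i j) x)\<^sup>2)"
    by (simp add: L2_set_def sum_nonneg block_def)
  also have "\<dots> = (\<Sum>(i, j)\<in>(SIGMA i:{..<N}. {..<m i}). (inner (U i j) x)\<^sup>2)"
    by (rule sum.Sigma) auto
  also have "\<dots> = (\<Sum>b\<in>Basis. (inner b x)\<^sup>2)"
    using sum.reindex_bij_betw[OF assms[unfolded block_decomposition_def columns_mat_1],
        of "\<lambda>b. (inner b x)\<^sup>2"]
    by (simp add: case_prod_unfold)
  also have "\<dots> = (norm x)\<^sup>2"
    unfolding power2_norm_eq_inner euclidean_inner[of x x]
    by (simp add: power2_eq_square inner_commute)
  finally show ?thesis .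
qed

lemma block_norm_sq_le:
  fixes U :: "nat \<Rightarrow> nat \<Rightarrow> real^'n"
  assumes "block_decomposition N m U"
    and "\<forall>i<N. is_norm (m i) (\<nu> i)" and "\<forall>i<N. euclidean_dominated (m i) (\<nu> i)"
    and "\<And>i. i < N \<Longrightarrow> Lc i \<le> M" and "0 \<le> M"
  shows "block_norm_sq N m U \<nu> Lc x \<le> M * (norm x)\<^sup>2"
proof -
  have "block_norm_sq N m U \<nu> Lc x \<le> (\<Sum>i<N. M * (L2_set (block m U i x) {..<m i})\<^sup>2)"
    unfolding block_norm_sq_def
  proof (rule sum_mono)
    fix i assume "i \<in> {..<N}"
    then have i: "i < N" by simp
    have R: "block m U i x \<in> Rspace (m i)" by (simp add: Rspace_def block_def)
    have "0 \<le> \<nu> i (block m U i x)" using assms(2) i R unfolding is_norm_def by blast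
    moreover have "\<nu> i (block m U i x) \<le> L2_set (block m U i x) {..<m i}"
      using assms(3) i R unfolding euclidean_dominated_def by blast
    ultimately show "Lc i * (\<nu> i (block m U i x))\<^sup>2 \<le> M * (L2_set (block m U i x) {..<m i})\<^sup>2"
      using assms(4)[OF i] assms(5) by (intro mult_mono power_mono) auto
  qed
  then show ?thesis by (simp add: sum_block_L2_set[OF assms(1)] flip: sum_distrib_left)
qed

section \<open>The two envelopes\<close>

lemma moreau_envelope_le: "moreau_envelope \<gamma> F x \<le> F x"
  unfolding moreau_envelope_def by (rule INF_lower2[of x]) auto

lemma moreau_minorant:
  fixes F :: "'a::euclidean_space \<Rightarrow> ereal"
  assumes "closed (epi F)" and "\<gamma> > 0" and lower: "\<And>x. ereal B \<le> F x"
  shows "\<exists>p. F p + ereal (1 / (2 * \<gamma>) * (norm (p - x))\<^sup>2) \<le> moreau_envelope \<gamma> F x"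
  unfolding moreau_envelope_def
proof (rule lsc_minimum_attained)
  show "ereal (B + 1 / (2 * \<gamma>) * (norm (u - x))\<^sup>2)
      \<le> F u + ereal (1 / (2 * \<gamma>) * (norm (u - x))\<^sup>2)" for u
    using add_right_mono[OF lower[of u], of "ereal (1 / (2 * \<gamma>) * (norm (u - x))\<^sup>2)"] by simp
qed (use assms in \<open>auto intro!: continuous_intros\<close>)

text \<open>The descent lemma: along the segment from \<open>x\<close> to \<open>u\<close> the difference of the two sides is
  monotone, because by the Lipschitz condition its derivative has a sign.\<close>

lemma lipschitz_gradient_descent:
  fixes f :: "'a::euclidean_space \<Rightarrow> real"
  assumes gderiv: "\<And>x. GDERIV f x :> gf x" and lip: "L-lipschitz_on UNIV gf"
  shows "f u \<le> f x + inner (gf x) (u - x) + L / 2 * (norm (u - x))\<^sup>2"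
proof -
  define v where "v = u - x"
  define \<phi> where "\<phi> t = f (x + t *\<^sub>R v) - t * inner (gf x) v - L / 2 * t\<^sup>2 * (norm v)\<^sup>2" for t
  have deriv: "(\<phi> has_real_derivative
      (inner (gf (x + t *\<^sub>R v)) v - inner (gf x) v - L * t * (norm v)\<^sup>2)) (at t)" for t
  proof -
    have "(f has_derivative (\<lambda>h. inner h (gf (x + t *\<^sub>R v)))) (at (x + t *\<^sub>R v))"
      using gderiv unfolding gderiv_def by blast
    moreover have "((\<lambda>t. x + t *\<^sub>R v) has_derivative (\<lambda>s. s *\<^sub>R v)) (at t)"
      by (auto intro!: derivative_eq_intros)
    ultimately have "((\<lambda>t. f (x + t *\<^sub>R v)) has_derivative
        (\<lambda>s. inner (s *\<^sub>R v) (gf (x + t *\<^sub>R v)))) (at t)"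
      by (rule has_derivative_compose[rotated])
    then have "((\<lambda>t. f (x + t *\<^sub>R v)) has_real_derivative inner (gf (x + t *\<^sub>R v)) v) (at t)"
      by (intro has_derivative_imp_has_field_derivative) (auto simp: inner_commute)
    then show ?thesis
      unfolding \<phi>_def by (auto intro!: derivative_eq_intros)
  qed
  have "\<phi> 1 \<le> \<phi> 0"
  proof (rule DERIV_nonpos_imp_nonincreasing[where f = \<phi>])
    fix t :: real assume t: "0 \<le> t" "t \<le> 1"
    have "inner (gf (x + t *\<^sub>R v)) v - inner (gf x) v
        \<le> norm (gf (x + t *\<^sub>R v) - gf x) * norm v"
      by (metis inner_diff_left norm_cauchy_schwarz)
    also have "\<dots> \<le> (L * norm (t *\<^sub>R v)) * norm v"
      using lipschitz_onD[OF lip, of "x + t *\<^sub>R v" x]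
      by (intro mult_right_mono) (auto simp: dist_norm)
    also have "\<dots> = L * t * (norm v)\<^sup>2" using t by (simp add: power2_eq_square)
    finally show "\<exists>y. (\<phi> has_real_derivative y) (at t) \<and> y \<le> 0" using deriv[of t] by auto
  qed simp
  then show ?thesis by (simp add: \<phi>_def v_def)
qed

lemma fb_envelope_le: "fb_envelope \<gamma> f gf \<psi> x \<le> ereal (f x) + \<psi> x"
  unfolding fb_envelope_def by (rule INF_lower2[of x]) auto

lemma fb_minorant:
  fixes f :: "'a::euclidean_space \<Rightarrow> real"
  assumes \<psi>: "closed (epi \<psi>)"
    and gderiv: "\<And>x. GDERIV f x :> gf x" and lip: "L-lipschitz_on UNIV gf"
    and "\<gamma> > 0" and "\<gamma> * L < 1" and lower: "\<And>x. ereal B \<le> ereal (f x) + \<psi> x"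
  shows "\<exists>p. ereal (f p) + \<psi> p + ereal (1 / (2 * (\<gamma> / (1 - \<gamma> * L))) * (norm (p - x))\<^sup>2)
    \<le> fb_envelope \<gamma> f gf \<psi> x"
proof -
  define g where "g u = f x + inner (gf x) (u - x) + 1 / (2 * \<gamma>) * (norm (u - x))\<^sup>2" for u
  define c where "c = 1 / (2 * (\<gamma> / (1 - \<gamma> * L)))"
  have c: "c = 1 / (2 * \<gamma>) - L / 2" "c > 0" using assms(4,5) by (auto simp: c_def field_simps)
  have "f u + c * (norm (u - x))\<^sup>2 \<le> g u" for u
    using lipschitz_gradient_descent[OF gderiv lip, of u x]
    unfolding g_def c(1) by (simp add: algebra_simps)
  then have descent: "ereal (f u) + \<psi> u + ereal (c * (norm (u - x))\<^sup>2) \<le> \<psi> u + ereal (g u)" for u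
    by (cases "\<psi> u") (auto simp: algebra_simps)
  have "\<exists>p. \<psi> p + ereal (g p) \<le> (INF u. \<psi> u + ereal (g u))"
  proof (rule lsc_minimum_attained[OF \<psi> _ \<open>c > 0\<close>])
    show "continuous_on UNIV g" unfolding g_def by (intro continuous_intros)
    show "ereal (B + c * (norm (u - x))\<^sup>2) \<le> \<psi> u + ereal (g u)" for u
      using add_right_mono[OF lower[of u], of "ereal (c * (norm (u - x))\<^sup>2)"] descent[of u]
      by (simp add: order_trans)
  qed
  then obtain p where "\<psi> p + ereal (g p) \<le> fb_envelope \<gamma> f gf \<psi> x"
    unfolding fb_envelope_def g_def by (auto simp: add.commute)
  with descent[of p] show ?thesis unfolding c_def by (blast intro: order_trans)
qed

theorem theorem1:
  fixes F \<psi> :: "real^'n \<Rightarrow> ereal"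
    and x0 :: "real^'n"
    and \<gamma> \<kappa> q R L :: real
    and N :: nat
    and m :: "nat \<Rightarrow> nat"
    and U :: "nat \<Rightarrow> nat \<Rightarrow> real^'n"
    and \<nu> :: "nat \<Rightarrow> (nat \<Rightarrow> real) \<Rightarrow> real"
    and Lc :: "nat \<Rightarrow> real"
    and f :: "real^'n \<Rightarrow> real"
    and gf G :: "real^'n \<Rightarrow> real^'n"
  assumes "\<forall>x. F x \<noteq> -\<infinity>"
    and "minimizers F \<noteq> {}"
    and "x0 \<in> edom F"
    and "\<gamma> > 0"
    and "\<kappa> > 0"
    and "1 \<le> q" and "q \<le> 2"
    and "sharp_growth F x0 \<kappa> q"
    and "block_decomposition N m U"
    and "\<forall>i<N. is_norm (m i) (\<nu> i)"
    and "\<forall>i<N. euclidean_dominated (m i) (\<nu> i)"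
  shows
    "(proper_closed_convex F \<and>
      (q < 2 \<longrightarrow> R > 0 \<and> bounded_level F (moreau_envelope \<gamma> F) x0 R)
      \<longrightarrow>
      envelope_growth F (moreau_envelope \<gamma> F) x0 (block_norm_sq N m U \<nu> (\<lambda>i. inverse \<gamma>))
        (if q = 2 then \<kappa> * \<gamma> / (\<gamma> * \<kappa> + 1)
         else \<kappa>\<^sup>2 * \<gamma>\<^sup>2 / (\<kappa> * \<gamma> + R powr (2 - q))\<^sup>2))
     \<and>
     ((\<forall>x. F x = ereal (f x) + \<psi> x) \<and>
      (\<forall>x. GDERIV f x :> gf x) \<and> L > 0 \<and> L-lipschitz_on UNIV gf \<and>
      proper_closed_convex \<psi> \<and>
      0 < \<gamma> * L \<and> \<gamma> * L < 1 \<and>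
      (\<forall>x. GDERIV (\<lambda>y. real_of_ereal (fb_envelope \<gamma> f gf \<psi> y)) x :> G x) \<and>
      (\<forall>i<N. Lc i > 0) \<and> block_lipschitz N m U \<nu> Lc G \<and>
      (q < 2 \<longrightarrow> R > 0 \<and> bounded_level F (fb_envelope \<gamma> f gf \<psi>) x0 R)
      \<longrightarrow>
      envelope_growth F (fb_envelope \<gamma> f gf \<psi>) x0 (block_norm_sq N m U \<nu> Lc)
        (if q = 2 then \<kappa> * (1 - \<gamma> * L) / ((\<gamma> * \<kappa> + 1 - \<gamma> * L) * Max (Lc ` {..<N}))
         else \<kappa>\<^sup>2 * \<gamma> * (1 - \<gamma> * L) /
           ((\<kappa> * \<gamma> + R powr (2 - q) * (1 - \<gamma> * L))\<^sup>2 * Max (Lc ` {..<N}))))"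
proof -
  note F = assms(1-3) and const = assms(4-7) and growth = assms(8)
  obtain B where B: "\<And>x. ereal B \<le> F x" and min: "minimizers F = {x. F x \<le> ereal B}"
    using minimum_value[OF F] by metis
  have weight_bound: "k * block_norm_sq N m U \<nu> W y \<le> k' * (norm y)\<^sup>2"
    if "\<And>i. i < N \<Longrightarrow> W i \<le> M" "0 \<le> M" "0 \<le> k" "k * M \<le> k'" for k k' M W y
  proof -
    have "k * block_norm_sq N m U \<nu> W y \<le> k * (M * (norm y)\<^sup>2)"
      using block_norm_sq_le[OF assms(9-11) that(1,2)] that(3) by (intro mult_left_mono) auto
    also have "\<dots> \<le> k' * (norm y)\<^sup>2"
      using mult_right_mono[OF that(4), of "(norm y)\<^sup>2"] by (simp add: mult.assoc)
    finally show ?thesis .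
  qed
  define \<rho> where "\<rho> = (if q = 2 then 1 else R powr (2 - q))"
  have comparison: "t\<^sup>2 \<le> \<rho> * t powr q"
    if "q < 2 \<longrightarrow> R > 0 \<and> bounded_level F E x0 R" "x \<in> level_set E x0"
      "0 \<le> t" "t \<le> norm (x - proj_min F x)" for E x t
  proof (cases "q = 2")
    case True
    then show ?thesis using that by (simp add: \<rho>_def)
  next
    case False
    then have "t \<le> R" using that const unfolding bounded_level_def by fastforce
    then show ?thesis using False that const square_le_powr by (simp add: \<rho>_def)
  qed
  have \<rho>_pos: "\<rho> > 0" if "q < 2 \<longrightarrow> R > 0 \<and> bounded_level F E x0 R" for E
    using that const by (auto simp: \<rho>_def)
  \<comment> \<open>The extra factor that separates the constants for \<open>q < 2\<close> from the sharper ones.\<close>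
  have factor: "(\<kappa> * s / (\<kappa> * s + r))\<^sup>2 / s \<le> \<kappa> / (\<kappa> * s + r)" if "s > 0" "r > 0" for s r
  proof -
    have pos: "\<kappa> * s + r > 0" using that const by (simp add: add_pos_pos)
    then have "\<kappa> * s / (\<kappa> * s + r) \<le> 1" using that by (subst divide_le_eq_1_pos) auto
    then have "\<kappa> / (\<kappa> * s + r) * (\<kappa> * s / (\<kappa> * s + r)) \<le> \<kappa> / (\<kappa> * s + r) * 1"
      using pos const by (intro mult_left_mono) auto
    moreover have "(\<kappa> * s / (\<kappa> * s + r))\<^sup>2 / s = \<kappa> / (\<kappa> * s + r) * (\<kappa> * s / (\<kappa> * s + r))"
      using that by (simp add: power2_eq_square)
    ultimately show ?thesis by simp
  qed
  show ?thesis
  proof (intro conjI impI, goal_cases)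
    case 1
    then have cl: "closed (epi F)" and R: "q < 2 \<longrightarrow> R > 0 \<and> bounded_level F (moreau_envelope \<gamma> F) x0 R"
      by (auto simp: proper_closed_convex_def)
    have "closed (minimizers F)"
      using closed_sublevel_add_continuous[OF cl continuous_on_const, of 0 B]
      by (simp add: min flip: zero_ereal_def)
    then have "envelope_growth F (moreau_envelope \<gamma> F) x0 (\<lambda>y. (norm y)\<^sup>2) (\<kappa> / (\<kappa> * \<gamma> + \<rho>))"
      using F const growth \<rho>_pos[OF R] moreau_envelope_le moreau_minorant[OF cl _ B] comparison[OF R]
      by (intro envelope_growth_of_minorant) auto
    then show ?case
    proof (rule envelope_growth_mono, intro weight_bound[where M = "inverse \<gamma>"])
      show "(if q = 2 then \<kappa> * \<gamma> / (\<gamma> * \<kappa> + 1) else \<kappa>\<^sup>2 * \<gamma>\<^sup>2 / (\<kappa> * \<gamma> + R powr (2 - q))\<^sup>2)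
          * inverse \<gamma> \<le> \<kappa> / (\<kappa> * \<gamma> + \<rho>)"
      proof (cases "q = 2")
        case True
        then show ?thesis using const by (simp add: \<rho>_def field_simps)
      next
        case False
        have "\<kappa>\<^sup>2 * \<gamma>\<^sup>2 / (\<kappa> * \<gamma> + \<rho>)\<^sup>2 * inverse \<gamma> = (\<kappa> * \<gamma> / (\<kappa> * \<gamma> + \<rho>))\<^sup>2 / \<gamma>"
          by (simp add: power_divide power_mult_distrib divide_inverse power_inverse)
        with False show ?thesis using factor[OF _ \<rho>_pos[OF R], of \<gamma>] const by (simp add: \<rho>_def)
      qed
    qed (use const in auto)
  next
    case 2
    then have split: "F x = ereal (f x) + \<psi> x" and gderiv: "GDERIV f x :> gf x" for x by auto
    from 2 have cl: "closed (epi \<psi>)" and lip: "L-lipschitz_on UNIV gf" and "\<gamma> * L < 1"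
      and Lc: "\<forall>i<N. Lc i > 0"
      and R: "q < 2 \<longrightarrow> R > 0 \<and> bounded_level F (fb_envelope \<gamma> f gf \<psi>) x0 R"
      by (auto simp: proper_closed_convex_def)
    define \<delta> where "\<delta> = 1 - \<gamma> * L"
    have \<delta>: "\<delta> > 0" using \<open>\<gamma> * L < 1\<close> by (simp add: \<delta>_def)
    define M where "M = Max (Lc ` {..<N})"
    have M: "Lc i \<le> M" if "i < N" for i using that unfolding M_def by (intro Max_ge) auto
    have "M > 0"
      using M[of 0] Lc block_decomposition_nonempty[OF assms(9)] by force
    have "continuous_on UNIV f"
      using gderiv unfolding gderiv_def
      by (meson continuous_at_imp_continuous_on has_derivative_continuous)
    then have "closed (minimizers F)"
      using closed_sublevel_add_continuous[OF cl, of f B] by (simp add: min split add.commute)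
    then have "envelope_growth F (fb_envelope \<gamma> f gf \<psi>) x0 (\<lambda>y. (norm y)\<^sup>2)
        (\<kappa> / (\<kappa> * (\<gamma> / \<delta>) + \<rho>))"
      using F const growth \<rho>_pos[OF R] \<delta> fb_envelope_le[of \<gamma> f gf \<psi>]
        fb_minorant[OF cl gderiv lip _ \<open>\<gamma> * L < 1\<close>, of B] B comparison[OF R]
      by (intro envelope_growth_of_minorant) (auto simp: \<delta>_def split)
    then show ?case
    proof (rule envelope_growth_mono, fold M_def, intro weight_bound[where M = M])
      have q2: "\<kappa> * \<delta> / ((\<gamma> * \<kappa> + \<delta>) * M) * M = \<kappa> / (\<kappa> * (\<gamma> / \<delta>) + 1)"
      proof -
        have "\<gamma> * \<kappa> + \<delta> > 0" using const \<delta> by (simp add: add_pos_pos)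
        moreover have "\<kappa> * (\<gamma> / \<delta>) + 1 = (\<gamma> * \<kappa> + \<delta>) / \<delta>" using \<delta> by (simp add: field_simps)
        ultimately show ?thesis using \<open>M > 0\<close> \<delta> by simp
      qed
      have "\<kappa>\<^sup>2 * \<gamma> * \<delta> / ((\<kappa> * \<gamma> + r * \<delta>)\<^sup>2 * M) * M \<le> \<kappa> / (\<kappa> * (\<gamma> / \<delta>) + r)" if "r > 0" for r
      proof -
        have "\<kappa> * \<gamma> + r * \<delta> > 0" using const \<delta> that by (simp add: add_pos_pos)
        moreover have "\<kappa> * (\<gamma> / \<delta>) + r = (\<kappa> * \<gamma> + r * \<delta>) / \<delta>" using \<delta> by (simp add: field_simps)
        ultimately have "\<kappa>\<^sup>2 * \<gamma> * \<delta> / ((\<kappa> * \<gamma> + r * \<delta>)\<^sup>2 * M) * M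
            = (\<kappa> * (\<gamma> / \<delta>) / (\<kappa> * (\<gamma> / \<delta>) + r))\<^sup>2 / (\<gamma> / \<delta>)"
          using \<open>M > 0\<close> \<delta> const by (simp add: power2_eq_square)
        then show ?thesis using factor[of "\<gamma> / \<delta>" r] \<delta> const that by simp
      qed
      with q2 \<rho>_pos[OF R] show "(if q = 2 then \<kappa> * (1 - \<gamma> * L) / ((\<gamma> * \<kappa> + 1 - \<gamma> * L) * M)
          else \<kappa>\<^sup>2 * \<gamma> * (1 - \<gamma> * L) / ((\<kappa> * \<gamma> + R powr (2 - q) * (1 - \<gamma> * L))\<^sup>2 * M)) * M
          \<le> \<kappa> / (\<kappa> * (\<gamma> / \<delta>) + \<rho>)"
        by (auto simp: \<rho>_def \<delta>_def add_diff_eq)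
      have "\<gamma> * \<kappa> + 1 - \<gamma> * L > 0" using const \<delta> by (simp add: \<delta>_def add_pos_pos add_diff_eq[symmetric])
      then show "0 \<le> (if q = 2 then \<kappa> * (1 - \<gamma> * L) / ((\<gamma> * \<kappa> + 1 - \<gamma> * L) * M)
          else \<kappa>\<^sup>2 * \<gamma> * (1 - \<gamma> * L) / ((\<kappa> * \<gamma> + R powr (2 - q) * (1 - \<gamma> * L))\<^sup>2 * M))"
        using const \<delta> \<open>M > 0\<close> by (simp add: \<delta>_def)
    qed (use M \<open>M > 0\<close> in auto)
  qed
qed

end
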